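(* For a given caching probability vector $\mathbf{b}=(b_1,\dots,b_{N_f})$ with $b_i\in[0,1]$ and $\sum_{i=1}^{N_f}b_i=M$, write $\overline b_i=1-b_i$, let $D(\mathbf{b},W_1)$ be the weighted average delay defined in the context, and consider minimizing $D(\mathbf{b},W_1)$ over $W_1$ subject to $$0\le W_1\le W,\qquad \zeta_{tot}\sum_{i=1}^{N_f}q_i(\overline b_i-\overline b_i^{\,k})<\mathcal{O}_1W_1,\qquad \zeta_{tot}\sum_{i=1}^{N_f}q_i\overline b_i^{\,k}<\mathcal{O}_2(W-W_1).$$ Then the objective function $D(\mathbf{b},W_1)$ is convex with respect to $W_1$ (under these constraints), and the optimal bandwidth allocation to the device-to-device communication is $$W_1^*=\frac{\zeta_{tot}\sum_{i=1}^{N_f}q_i(\overline b_i-\overline b_i^{\,k})+\varpi\Big(\mathcal{O}_2W-\zeta_{tot}\sum_{i=1}^{N_f}q_i\overline b_i^{\,k}\Big)}{\mathcal{O}_1+\varpi\,\mathcal{O}_2},\qquad \varpi=\sqrt{\frac{\mathcal{O}_1\sum_{i=1}^{N_f}q_i(\overline b_i-\overline b_i^{\,k})}{\mathcal{O}_2\sum_{i=1}^{N_f}q_i\overline b_i^{\,k}}}.$$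
   Context: A cluster has a fixed number $k$ of devices; the library has $N_f$ files, each device can cache $M$ files ($M<N_f$), and file $i$ is requested with Zipf probability $q_i=\frac{i^{-\beta}}{\sum_{l=1}^{N_f}l^{-\beta}}$, where $\beta$ is the popularity skewness parameter. Each device caches file $i$ with probability $b_i$. The total bandwidth $W$ is split as $W=W_1+W_2$ between device-to-device (D2D) communication ($W_1$) and base-station-to-device communication ($W_2$). $\zeta_{tot}$ is the total request arrival rate of the cluster, and $\overline S$ is the mean file size. Set $$\mathcal{O}_1=\frac{\mathrm{P_{c_d}}\log_2(1+\theta)}{\overline S},\qquad \mathcal{O}_2=\frac{\mathrm{P_{c_b}}\log_2(1+\theta)}{\overline S},$$ where $\theta$ is the signal-to-interference-ratio threshold and the D2D and base-station coverage probabilities are $$\mathrm{P_{c_d}}=\frac{1}{4\sigma^2\Big(\pi\lambda_p\theta^{2/\alpha}\Gamma(1+\tfrac2\alpha)\Gamma(1-\tfrac2\alpha)+\tfrac{1}{4\sigma^2}\Big)},\qquad \mathrm{P_{c_b}}=\frac{1}{{}_2F_1(1,-\tfrac{2}{\alpha};1-\tfrac{2}{\alpha};-\theta)},$$ with $\lambda_p$ the density of clusters, $\sigma$ the standard deviation of device positions around their cluster center, $\alpha>2$ the path-loss exponent, and ${}_2F_1$ the Gaussian hypergeometric function. The service rates of the D2D and base-station queues are $\mu_1=\mathcal{O}_1W_1$ and $\mu_2=\mathcal{O}_2W_2$; the two strict inequalities in the claim are the stability conditions of these queues. The weighted average delay per request is $$D(\mathbf{b},W_1)=\frac{\sum_{i=1}^{N_f}q_i\big((1-b_i)-(1-b_i)^k\big)}{\mathcal{O}_1W_1-\zeta_{tot}\sum_{i=1}^{N_f}q_i\big((1-b_i)-(1-b_i)^k\big)}+\frac{\sum_{i=1}^{N_f}q_i(1-b_i)^k}{\mathcal{O}_2W_2-\zeta_{tot}\sum_{i=1}^{N_f}q_i(1-b_i)^k},\qquad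 W_2=W-W_1 .$$
   Formalization: The constraints are assumed feasible; if the D2D sum Σq_i(b̄_i−b̄_i^k) is 0 (k=1 or all b_i in {0,1}), W1*=0 violates the strict constraint and no minimiser exists, so there W1* is only shown to be a limit of feasible points with D(W1* ) the infimum. *)

theory Defs
  imports "HOL-Complex_Analysis.Complex_Analysis"
begin

definition zipf :: "nat \<Rightarrow> real \<Rightarrow> nat \<Rightarrow> real" where
  "zipf N \<beta> i = real i powr (- \<beta>) / (\<Sum>l=1..N. real l powr (- \<beta>))"

text \<open>
  The Gauss series converges only for \<open>norm u < 1\<close>, but the coverage probability evaluates
  \<open>\<^sub>2F\<^sub>1\<close> at \<open>-\<theta>\<close> for arbitrary \<open>\<theta> > 0\<close>. So \<open>\<^sub>2F\<^sub>1\<close> is the principal branch: the holomorphic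
  function on the complex plane cut along \<open>[1, \<infinity>)\<close> that agrees with the series on the unit disc.
  It is meant for \<open>c\<close> not in \<open>{0, -1, -2, \<dots>}\<close> and \<open>z\<close> off the cut.
\<close>

definition hyp2F1 :: "complex \<Rightarrow> complex \<Rightarrow> complex \<Rightarrow> complex \<Rightarrow> complex" where
  "hyp2F1 a b c z = (THE w. \<exists>f.
     f holomorphic_on - (complex_of_real ` {1..}) \<and>
     (\<forall>u. norm u < 1 \<longrightarrow> (\<lambda>n. fps_nth (fps_hypergeo [a, b] [c] 1) n * u ^ n) sums f u) \<and>
     w = f z)"

definition d2d_coverage :: "real \<Rightarrow> real \<Rightarrow> real \<Rightarrow> real \<Rightarrow> real" where
  "d2d_coverage dens \<sigma> \<alpha> \<theta> =
     1 / (4 * \<sigma>\<^sup>2 * (pi * dens * \<theta> powr (2 / \<alpha>) * Gamma (1 + 2 / \<alpha>) * Gamma (1 - 2 / \<alpha>)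
                   + 1 / (4 * \<sigma>\<^sup>2)))"

text \<open>With real parameters and a real argument below 1 the value of \<open>\<^sub>2F\<^sub>1\<close> is real, so taking
  \<^const>\<open>Re\<close> only changes the type.\<close>

definition bs_coverage :: "real \<Rightarrow> real \<Rightarrow> real" where
  "bs_coverage \<alpha> \<theta> =
     1 / Re (hyp2F1 1 (of_real (- 2 / \<alpha>)) (of_real (1 - 2 / \<alpha>)) (of_real (- \<theta>)))"

definition d2d_share :: "nat \<Rightarrow> real \<Rightarrow> nat \<Rightarrow> (nat \<Rightarrow> real) \<Rightarrow> real" where
  "d2d_share N \<beta> k b = (\<Sum>i=1..N. zipf N \<beta> i * ((1 - b i) - (1 - b i) ^ k))"

definition bs_share :: "nat \<Rightarrow> real \<Rightarrow> nat \<Rightarrow> (nat \<Rightarrow> real) \<Rightarrow> real" where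
  "bs_share N \<beta> k b = (\<Sum>i=1..N. zipf N \<beta> i * (1 - b i) ^ k)"

text \<open>If \<open>d2d_share N \<beta> k b = 0\<close> (that is, \<open>k = 1\<close> or every \<open>b i\<close> is 0 or 1), stability of the D2D queue
  reads \<open>0 < O1 * W1\<close> and the delay has no minimiser, only the infimum approached as \<open>W1\<close> tends
  to 0. The value at \<open>W1 = 0\<close> is then that infimum, because \<open>0 / 0 = 0\<close>.\<close>

definition avg_delay ::
  "nat \<Rightarrow> real \<Rightarrow> nat \<Rightarrow> real \<Rightarrow> real \<Rightarrow> real \<Rightarrow> real \<Rightarrow> (nat \<Rightarrow> real) \<Rightarrow> real \<Rightarrow> real" where
  "avg_delay N \<beta> k \<zeta> O1 O2 W b W1 =
     d2d_share N \<beta> k b / (O1 * W1 - \<zeta> * d2d_share N \<beta> k b)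
   + bs_share N \<beta> k b / (O2 * (W - W1) - \<zeta> * bs_share N \<beta> k b)"

definition feasible_bandwidths ::
  "nat \<Rightarrow> real \<Rightarrow> nat \<Rightarrow> real \<Rightarrow> real \<Rightarrow> real \<Rightarrow> real \<Rightarrow> (nat \<Rightarrow> real) \<Rightarrow> real set" where
  "feasible_bandwidths N \<beta> k \<zeta> O1 O2 W b =
     {W1. 0 \<le> W1 \<and> W1 \<le> W \<and>
          \<zeta> * d2d_share N \<beta> k b < O1 * W1 \<and>
          \<zeta> * bs_share N \<beta> k b < O2 * (W - W1)}"

end

theory Submission
  imports Defs
begin

text \<open>
  Let \<open>u = O1 * x - \<zeta> * a\<close> and \<open>v = O2 * (W - x) - \<zeta> * c\<close> be the spare capacities of the two queues,
  where \<open>a\<close> and \<open>c\<close> are the two request shares. The combination \<open>K = O2 * u + O1 * v\<close> does not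
  depend on \<open>x\<close>, so \<open>(a/u + c/v) * K\<close> equals a constant plus \<open>O1 * a * v/u + O2 * c * u/v\<close>; completing
  the square shows that the delay exceeds a constant by \<open>O2 * c * (u - \<omega> * v)\<^sup>2 / (K * u * v)\<close>. The
  minimiser is the solution of the linear equation \<open>u = \<omega> * v\<close>. The signs
  of \<open>O1\<close> and \<open>O2\<close> come from feasibility rather than from the coverage formulas: a stable bandwidth
  split can exist only if both are positive.
\<close>

text \<open>Both delay terms have this form in the bandwidth. The function \<open>inverse\<close> is
  convex on the positive reals, and precomposing with an affine map and scaling by \<open>c\<close>
  preserve convexity.\<close>

lemma convex_on_divide_affine:
  fixes c p q :: real
  assumes "convex S" "c \<ge> 0" and pos: "\<And>x. x \<in> S \<Longrightarrow> p * x + q > 0"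
  shows "convex_on S (\<lambda>x. c / (p * x + q))"
proof -
  have "convex_on S (\<lambda>x. inverse (p * x + q))"
  proof (rule convex_onI[OF _ \<open>convex S\<close>])
    fix t x y :: real
    assume t: "0 < t" "t < 1" and xy: "x \<in> S" "y \<in> S"
    have "p * ((1 - t) *\<^sub>R x + t *\<^sub>R y) + q = (1 - t) *\<^sub>R (p * x + q) + t *\<^sub>R (p * y + q)"
      by (simp add: algebra_simps)
    then show "inverse (p * ((1 - t) *\<^sub>R x + t *\<^sub>R y) + q)
        \<le> (1 - t) * inverse (p * x + q) + t * inverse (p * y + q)"
      using convex_onD[OF convex_on_inverse[of "{0<..}"], of t "p * x + q" "p * y + q"] t pos xy
      by simp
  qed
  then show ?thesis
    using convex_on_cmul[OF \<open>c \<ge> 0\<close>] by (simp add: divide_inverse)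
qed

text \<open>The choice of \<open>w\<close> turns \<open>p * a\<close> into
  \<open>q * c * w\<^sup>2\<close>, so the non-mixed terms of \<open>(a * v + c * u) * K\<close>
  become \<open>q * c * (u\<^sup>2 + w\<^sup>2 * v\<^sup>2)\<close>, a square plus a multiple of
  \<open>u * v\<close>.\<close>

lemma sum_divide_completed_square:
  fixes a c p q u v w K :: real
  assumes "u > 0" "v > 0" "p > 0" "q > 0" "c > 0"
    and K: "K = q * u + p * v" and w: "w\<^sup>2 = (p * a) / (q * c)"
  shows "a / u + c / v = (q * a + p * c + 2 * q * c * w) / K + q * c * (u - w * v)\<^sup>2 / (K * u * v)"
proof -
  have "K > 0"
    using assms by (simp add: add_pos_pos)
  have "p * a = q * c * w\<^sup>2"
    using w assms by simp
  then have "(a * v + c * u) * K = (q * a + p * c + 2 * q * c * w) * (u * v) + q * c * (u - w * v)\<^sup>2"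
    unfolding K by algebra
  moreover have "a / u + c / v = (a * v + c * u) * K / (K * u * v)"
    using assms(1,2) \<open>K > 0\<close> by (simp add: field_simps)
  ultimately show ?thesis
    using assms(1,2) \<open>K > 0\<close> by (simp add: add_divide_distrib)
qed

lemma zipf_pos:
  assumes "i \<in> {1..N}"
  shows "zipf N \<beta> i > 0"
proof -
  have "(\<Sum>l=1..N. real l powr (- \<beta>)) > 0"
    using assms by (intro sum_pos) auto
  then show ?thesis
    using assms by (simp add: zipf_def)
qed

lemma d2d_share_nonneg:
  assumes "k \<ge> 1" "\<forall>i\<in>{1..N}. 0 \<le> b i \<and> b i \<le> 1"
  shows "d2d_share N \<beta> k b \<ge> 0"
  unfolding d2d_share_def
proof (intro sum_nonneg mult_nonneg_nonneg)
  fix i assume i: "i \<in> {1..N}"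
  show "zipf N \<beta> i \<ge> 0"
    using zipf_pos[OF i] by (rule less_imp_le)
  show "(1 - b i) - (1 - b i) ^ k \<ge> 0"
    using power_decreasing[of 1 k "1 - b i"] assms i by simp
qed

text \<open>The caching probabilities cannot all be 1, and a file with \<open>b j < 1\<close>
  contributes a positive term.\<close>

lemma bs_share_pos:
  assumes "\<forall>i\<in>{1..N}. 0 \<le> b i \<and> b i \<le> 1" and "(\<Sum>i=1..N. b i) < real N"
  shows "bs_share N \<beta> k b > 0"
proof -
  have "\<exists>j\<in>{1..N}. b j < 1"
  proof (rule ccontr)
    assume "\<not> ?thesis"
    then have "(\<Sum>i=1..N. b i) \<ge> (\<Sum>i=1..N. 1)"
      by (intro sum_mono) force
    with assms(2) show False by simp
  qed
  then obtain j where j: "j \<in> {1..N}" "b j < 1" by blast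
  show ?thesis
    unfolding bs_share_def
    by (rule sum_pos2[OF _ j(1)])
       (use assms(1) j zipf_pos less_imp_le[OF zipf_pos] in \<open>auto intro!: mult_pos_pos mult_nonneg_nonneg\<close>)
qed

text \<open>With nonnegative loads the two stability conditions already force
  \<open>0 < W1 < W\<close>, so only their two endpoints remain.\<close>

lemma feasible_bandwidths_eq:
  assumes "O1 > 0" "O2 > 0" "\<zeta> * d2d_share N \<beta> k b \<ge> 0" "\<zeta> * bs_share N \<beta> k b \<ge> 0"
  shows "feasible_bandwidths N \<beta> k \<zeta> O1 O2 W b =
    {\<zeta> * d2d_share N \<beta> k b / O1 <..< W - \<zeta> * bs_share N \<beta> k b / O2}"
proof -
  have "0 \<le> x \<and> x \<le> W"
    if "\<zeta> * d2d_share N \<beta> k b < O1 * x" "\<zeta> * bs_share N \<beta> k b < O2 * (W - x)" for x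
  proof -
    have "0 < O1 * x" "0 < O2 * (W - x)"
      using assms(3,4) that by linarith+
    with assms(1,2) show ?thesis
      by (simp add: zero_less_mult_iff)
  qed
  then show ?thesis
    using assms(1,2) by (fastforce simp: feasible_bandwidths_def field_simps)
qed

theorem lemma7:
  fixes N k M :: nat
    and \<beta> \<zeta> W S dens \<sigma> \<alpha> \<theta> O1 O2 \<omega> W1opt :: real
    and b :: "nat \<Rightarrow> real"
    and F :: "real set" and D :: "real \<Rightarrow> real"
  assumes "k \<ge> 1" and "M < N"
    and "\<alpha> > 2" and "dens > 0" and "\<sigma> > 0" and "\<theta> > 0" and "S > 0" and "\<zeta> \<ge> 0"
    and b_prob: "\<forall>i\<in>{1..N}. 0 \<le> b i \<and> b i \<le> 1"
    and b_sum: "(\<Sum>i=1..N. b i) = real M"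
    and O1: "O1 = d2d_coverage dens \<sigma> \<alpha> \<theta> * log 2 (1 + \<theta>) / S"
    and O2: "O2 = bs_coverage \<alpha> \<theta> * log 2 (1 + \<theta>) / S"
    and D: "D = avg_delay N \<beta> k \<zeta> O1 O2 W b"
    and F: "F = feasible_bandwidths N \<beta> k \<zeta> O1 O2 W b"
    and feasible: "F \<noteq> {}"
    and omega: "\<omega> = sqrt ((O1 * d2d_share N \<beta> k b) / (O2 * bs_share N \<beta> k b))"
    and W1opt: "W1opt = (\<zeta> * d2d_share N \<beta> k b + \<omega> * (O2 * W - \<zeta> * bs_share N \<beta> k b))
                        / (O1 + \<omega> * O2)"
  shows "convex_on F D
    \<and> (d2d_share N \<beta> k b \<noteq> 0 \<longrightarrow> {W1. is_arg_min D (\<lambda>x. x \<in> F) W1} = {W1opt})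
    \<and> W1opt \<in> closure F \<and> D W1opt = (INF W1\<in>F. D W1)"
proof -
  define a where "a = d2d_share N \<beta> k b"
  define c where "c = bs_share N \<beta> k b"
  define u where "u x = O1 * x - \<zeta> * a" for x
  define v where "v x = O2 * (W - x) - \<zeta> * c" for x
  define K where "K = O1 * O2 * W - O2 * \<zeta> * a - O1 * \<zeta> * c"
  have a: "a \<ge> 0"
    unfolding a_def using \<open>k \<ge> 1\<close> b_prob by (rule d2d_share_nonneg)
  have c: "c > 0"
    unfolding c_def using b_prob b_sum \<open>M < N\<close> by (intro bs_share_pos) auto
  have za: "\<zeta> * a \<ge> 0" and zc: "\<zeta> * c \<ge> 0"
    using a c \<open>\<zeta> \<ge> 0\<close> by auto
  have D_eq: "D x = a / u x + c / v x" for x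
    by (simp add: D avg_delay_def a_def c_def u_def v_def)

  obtain x0 where x0: "0 \<le> x0" "x0 \<le> W" "\<zeta> * a < O1 * x0" "\<zeta> * c < O2 * (W - x0)"
    using feasible unfolding F feasible_bandwidths_def a_def c_def by blast
  have "0 < O1 * x0" "0 < O2 * (W - x0)"
    using x0 za zc by linarith+
  with x0 have p: "O1 > 0" and q: "O2 > 0"
    by (auto simp: zero_less_mult_iff)

  have F_eq: "F = {\<zeta> * a / O1 <..< W - \<zeta> * c / O2}"
    unfolding F a_def c_def using p q za zc by (intro feasible_bandwidths_eq) (auto simp: a_def c_def)
  have F_iff: "x \<in> F \<longleftrightarrow> u x > 0 \<and> v x > 0" for x
    using p q by (auto simp: F_eq u_def v_def field_simps)
  have K_eq: "K = O2 * u x + O1 * v x" for x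
    by (simp add: K_def u_def v_def algebra_simps)
  have "x0 \<in> F"
    using x0 by (simp add: F_iff u_def v_def)
  then have K: "K > 0"
    using K_eq[of x0] p q by (simp add: F_iff add_pos_pos)

  have "convex F"
    by (simp add: F_eq)
  have conv: "convex_on F D"
  proof -
    have "convex_on F (\<lambda>x. a / (O1 * x + - (\<zeta> * a)))"
      using \<open>convex F\<close> a by (rule convex_on_divide_affine) (simp add: F_iff u_def)
    moreover have "convex_on F (\<lambda>x. c / (- O2 * x + (O2 * W - \<zeta> * c)))"
      using \<open>convex F\<close> c by (intro convex_on_divide_affine) (auto simp: F_iff v_def algebra_simps)
    ultimately have "convex_on F (\<lambda>x. a / (O1 * x + - (\<zeta> * a)) + c / (- O2 * x + (O2 * W - \<zeta> * c)))"
      by (rule convex_on_add)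
    moreover have "D = (\<lambda>x. a / (O1 * x + - (\<zeta> * a)) + c / (- O2 * x + (O2 * W - \<zeta> * c)))"
      by (simp add: fun_eq_iff D_eq u_def v_def algebra_simps)
    ultimately show ?thesis by simp
  qed

  have \<omega>: "\<omega> \<ge> 0" and \<omega>_sq: "\<omega>\<^sup>2 = (O1 * a) / (O2 * c)"
    using omega p q a c by (simp_all add: a_def c_def)
  have den: "O1 + \<omega> * O2 > 0"
    using p q \<omega> by (simp add: add_pos_nonneg)
  have opt_iff: "u x = \<omega> * v x \<longleftrightarrow> x = W1opt" for x
    using den by (auto simp: W1opt u_def v_def a_def[symmetric] c_def[symmetric] field_simps)
  have opt: "u W1opt = \<omega> * v W1opt"
    by (simp add: opt_iff)
  \<comment> \<open>Substituting \<open>u = \<omega> * v\<close> into \<open>K\<close> gives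
    positivity of \<open>v\<close> at \<open>W1opt\<close> even when \<open>\<omega> = 0\<close>,
    where \<open>u\<close> vanishes and \<open>W1opt\<close> lies outside \<open>F\<close>.\<close>
  have "K = (O1 + \<omega> * O2) * v W1opt"
    using K_eq[of W1opt] opt by (simp add: algebra_simps)
  with K den have v_opt: "v W1opt > 0"
    by (simp add: zero_less_mult_iff)

  have D_square: "D x = (O2 * a + O1 * c + 2 * O2 * c * \<omega>) / K + O2 * c * (u x - \<omega> * v x)\<^sup>2 / (K * u x * v x)"
    if "x \<in> F" for x
    unfolding D_eq using that p q c K_eq \<omega>_sq
    by (intro sum_divide_completed_square) (auto simp: F_iff)

  show ?thesis
  \<comment> \<open>For \<open>a > 0\<close> the candidate is interior and is the unique minimiser.
    For \<open>a = 0\<close> it is the excluded left endpoint 0 of \<open>F\<close>, so only the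
    infimum can be identified.\<close>
  proof (cases "a = 0")
    case False
    with p q a c have "\<omega> > 0"
      by (simp add: omega a_def[symmetric] c_def[symmetric])
    then have opt_F: "W1opt \<in> F"
      using v_opt opt by (simp add: F_iff)
    \<comment> \<open>The square vanishes at \<open>W1opt\<close> alone, which yields
      uniqueness.\<close>
    have less: "D W1opt < D x" if "x \<in> F" "x \<noteq> W1opt" for x
    proof -
      have "u x - \<omega> * v x \<noteq> 0"
        using that(2) opt_iff by simp
      then have "O2 * c * (u x - \<omega> * v x)\<^sup>2 / (K * u x * v x) > 0"
        using that(1) K q c by (simp add: F_iff)
      then show ?thesis
        using D_square[OF that(1)] D_square[OF opt_F] opt by simp
    qed
    then have le: "D W1opt \<le> D x" if "x \<in> F" for x
      using that by (cases "x = W1opt") (auto intro: less_imp_le)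
    have "{W1. is_arg_min D (\<lambda>x. x \<in> F) W1} = {W1opt}"
      using opt_F less le by (fastforce simp: is_arg_min_def)
    moreover have "D W1opt = (INF W1\<in>F. D W1)"
      using opt_F le by (intro cInf_eq_minimum[symmetric]) auto
    ultimately show ?thesis
      using conv opt_F closure_subset by auto
  next
    case True
    then have "\<omega> = 0"
      by (simp add: omega a_def)
    then have opt0: "W1opt = 0"
      using True by (simp add: W1opt a_def)
    define r where "r = W - \<zeta> * c / O2"
    have F0: "F = {0<..<r}"
      using True by (simp add: F_eq r_def)
    have r: "r > 0"
      using \<open>x0 \<in> F\<close> F0 by simp
    \<comment> \<open>This includes \<open>x = 0\<close>, where the first term is
      \<open>0 / 0 = 0\<close>.\<close>
    have D0: "D x = c / v x" for x
      using True by (simp add: D_eq)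
    have "D 0 \<le> D x" if "x \<in> F" for x
    proof -
      have "v x > 0"
        using that by (simp add: F_iff)
      moreover have "v x \<le> v 0"
        using that q by (simp add: F0 v_def)
      ultimately show ?thesis
        using c unfolding D0 by (intro divide_left_mono) auto
    qed
    \<comment> \<open>As 0 is not in \<open>F\<close>, a lower bound on \<open>F\<close> is carried
      to \<open>D 0\<close> by right-continuity at 0.\<close>
    moreover have "y \<le> D 0" if "\<And>x. x \<in> F \<Longrightarrow> y \<le> D x" for y
    proof (rule tendsto_lowerbound)
      have "v 0 \<noteq> 0"
        using v_opt opt0 by simp
      then show "(D \<longlongrightarrow> D 0) (at_right 0)"
        unfolding D0 v_def by (intro tendsto_intros) simp
      show "\<forall>\<^sub>F x in at_right 0. y \<le> D x"
        using eventually_at_right_less[of "0::real"] eventually_at_right_real[OF r]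
        by eventually_elim (use that F0 in auto)
    qed simp
    ultimately have "D 0 = (INF W1\<in>F. D W1)"
      using feasible by (intro cInf_eq_non_empty[symmetric]) auto
    moreover have "0 \<in> closure F"
      using r by (simp add: F0)
    ultimately show ?thesis
      using conv True by (simp add: opt0 a_def)
  qed
qed

end
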